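(* Let $T:X\to X$ be a homeomorphism of a compact metric space $X$, let $l\ge1$, and let $\Psi:X\to U(l)$ and $\rho:X\to\mathbb{R}^l$ be continuous. For $\lambda\in(0,1)$ let $u_\lambda:X\to\mathbb{R}^l$ be the unique continuous solution of $\lambda u_\lambda(Tx)-\Psi(x)u_\lambda(x)=\rho(x)$ for all $x\in X$, let $$F_\lambda:X\times\mathbb{R}^l\to X\times\mathbb{R}^l,\qquad F_\lambda(x,v)=(Tx,\lambda^{-1}(\Psi(x)v+\rho(x))),$$ and let $G_\lambda:=F_\lambda^{-1}$. Then for every $\lambda\in(0,1)$ the section $u_\lambda$ is invariant under $G_\lambda$, that is, $G_\lambda(x,u_\lambda(x))=(T^{-1}x,u_\lambda(T^{-1}x))$ for all $x\in X$. Moreover, for every $(x,v)\in X\times\mathbb{R}^l$, $$\lim_{n\to\infty}\left|u_\lambda(T^{-n}x)-\pi_2\big(G_\lambda^n(x,v)\big)\right|=0,$$ where $\pi_2:X\times\mathbb{R}^l\to\mathbb{R}^l$ is the projection to the second factor.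
   Context: $U(l)$ denotes the orthogonal group of $\mathbb{R}^l$. The unique continuous solution is $u_\lambda(x)=-\sum_{j\ge0}\lambda^j\Psi(x)^{-1}\Psi(Tx)^{-1}\cdots\Psi(T^jx)^{-1}\rho(T^jx)$. *)

theory Defs
  imports "HOL-Analysis.Analysis"
begin

text \<open>The compact metric space is the whole type \<open>'a\<close>, and \<open>\<real>\<^sup>l\<close> is \<open>real ^ 'l\<close>; index types are nonempty,
  so \<open>l \<ge> 1\<close> holds automatically.\<close>

definition cohom_solution ::
  "('a::metric_space \<Rightarrow> 'a) \<Rightarrow> ('a \<Rightarrow> real ^ 'l ^ 'l) \<Rightarrow> ('a \<Rightarrow> real ^ 'l) \<Rightarrow> real \<Rightarrow> ('a \<Rightarrow> real ^ 'l) \<Rightarrow> bool"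
  where "cohom_solution T \<Psi> \<rho> lam u \<longleftrightarrow>
    continuous_on UNIV u \<and> (\<forall>x. lam *\<^sub>R u (T x) - \<Psi> x *v u x = \<rho> x)"

definition cohom_sol ::
  "('a::metric_space \<Rightarrow> 'a) \<Rightarrow> ('a \<Rightarrow> real ^ 'l ^ 'l) \<Rightarrow> ('a \<Rightarrow> real ^ 'l) \<Rightarrow> real \<Rightarrow> 'a \<Rightarrow> real ^ 'l"
  where "cohom_sol T \<Psi> \<rho> lam = (THE u. cohom_solution T \<Psi> \<rho> lam u)"

definition skew_F ::
  "('a \<Rightarrow> 'a) \<Rightarrow> ('a \<Rightarrow> real ^ 'l ^ 'l) \<Rightarrow> ('a \<Rightarrow> real ^ 'l) \<Rightarrow> real \<Rightarrow> 'a \<times> (real ^ 'l) \<Rightarrow> 'a \<times> (real ^ 'l)"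
  where "skew_F T \<Psi> \<rho> lam = (\<lambda>(x, v). (T x, inverse lam *\<^sub>R (\<Psi> x *v v + \<rho> x)))"

definition skew_G ::
  "('a \<Rightarrow> 'a) \<Rightarrow> ('a \<Rightarrow> real ^ 'l ^ 'l) \<Rightarrow> ('a \<Rightarrow> real ^ 'l) \<Rightarrow> real \<Rightarrow> 'a \<times> (real ^ 'l) \<Rightarrow> 'a \<times> (real ^ 'l)"
  where "skew_G T \<Psi> \<rho> lam = inv (skew_F T \<Psi> \<rho> lam)"

text \<open>The next two lemmas show that the description in \<open>cohom_sol\<close> and the inverse in \<open>skew_G\<close>
  are well defined under the standing assumptions.\<close>

lemma orthogonal_matrix_cancel:
  fixes A :: "real ^ 'l ^ 'l"
  assumes "orthogonal_matrix A"
  shows "A *v (transpose A *v v) = v" "transpose A *v (A *v v) = v"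
  using assms by (simp_all add: orthogonal_matrix_def matrix_vector_mul_assoc del: transpose_matrix_vector)

lemma norm_orthogonal_matrix_transpose:
  fixes A :: "real ^ 'l ^ 'l"
  assumes "orthogonal_matrix A"
  shows "norm (transpose A *v v) = norm v"
proof -
  have "orthogonal_matrix (transpose A)"
    using assms by (simp add: orthogonal_matrix_def)
  then have "orthogonal_transformation ((*v) (transpose A))"
    by (simp add: orthogonal_transformation_matrix)
  then show ?thesis
    by (rule orthogonal_transformation_norm)
qed

lemma cohom_solution_ex1:
  fixes T :: "'a::metric_space \<Rightarrow> 'a" and \<Psi> :: "'a \<Rightarrow> real ^ 'l ^ 'l" and \<rho> :: "'a \<Rightarrow> real ^ 'l"
  assumes cpt: "compact (UNIV :: 'a set)"
    and T: "continuous_on UNIV T"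
    and Psi: "continuous_on UNIV \<Psi>" "\<And>x. orthogonal_matrix (\<Psi> x)"
    and rho: "continuous_on UNIV \<rho>"
    and lam: "0 < lam" "lam < 1"
  shows "\<exists>!u. cohom_solution T \<Psi> \<rho> lam u"
proof -
  define h where "h u x = transpose (\<Psi> x) *v (lam *\<^sub>R u (T x) - \<rho> x)"
    for u :: "'a \<Rightarrow> real ^ 'l" and x
  have bc: "u \<in> bcontfun" if "continuous_on UNIV u" for u :: "'a \<Rightarrow> real ^ 'l"
    using that compact_imp_bounded[OF compact_continuous_image[OF that cpt]]
    by (simp add: bcontfun_def)
  have cont_h: "continuous_on UNIV (h u)" if "continuous_on UNIV u" for u
  proof -
    have "continuous_on UNIV (\<lambda>x. u (T x))"
      using continuous_on_compose2[OF that T] by simp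
    then show ?thesis
      unfolding h_def matrix_vector_mult_def transpose_def
      by (intro continuous_intros Psi rho) simp_all
  qed
  have sol_iff: "(\<forall>x. lam *\<^sub>R u (T x) - \<Psi> x *v u x = \<rho> x) \<longleftrightarrow> h u = u" for u
  proof -
    have "lam *\<^sub>R u (T x) - \<Psi> x *v u x = \<rho> x \<longleftrightarrow> h u x = u x" for x
    proof
      assume "lam *\<^sub>R u (T x) - \<Psi> x *v u x = \<rho> x"
      then have "lam *\<^sub>R u (T x) - \<rho> x = \<Psi> x *v u x"
        by (simp add: algebra_simps)
      then show "h u x = u x"
        by (simp add: h_def orthogonal_matrix_cancel Psi del: transpose_matrix_vector)
    next
      assume "h u x = u x"
      then have "\<Psi> x *v u x = lam *\<^sub>R u (T x) - \<rho> x"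
        by (metis h_def orthogonal_matrix_cancel(1) Psi(2))
      then show "lam *\<^sub>R u (T x) - \<Psi> x *v u x = \<rho> x"
        by simp
    qed
    then show ?thesis
      by (auto simp: fun_eq_iff)
  qed
  define H where "H f = Bcontfun (h (apply_bcontfun f))" for f :: "'a \<Rightarrow>\<^sub>C (real ^ 'l)"
  have H: "apply_bcontfun (H f) = h (apply_bcontfun f)" for f
    unfolding H_def by (intro Bcontfun_inverse bc cont_h continuous_on_apply_bcontfun)
  have "dist (H f) (H g) \<le> lam * dist f g" for f g
  proof (rule dist_bound)
    fix x
    have "h f x - h g x = transpose (\<Psi> x) *v (lam *\<^sub>R (f (T x) - g (T x)))"
      unfolding h_def by (simp add: algebra_simps flip: matrix_vector_mult_diff_distrib
          del: transpose_matrix_vector)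
    then have "dist (h f x) (h g x) = lam * dist (f (T x)) (g (T x))"
      using lam Psi(2) by (simp add: dist_norm norm_orthogonal_matrix_transpose
          del: transpose_matrix_vector)
    also have "\<dots> \<le> lam * dist f g"
      using lam by (intro mult_left_mono dist_bounded) simp
    finally show "dist (H f x) (H g x) \<le> lam * dist f g"
      by (simp add: H)
  qed
  then have "\<exists>!f. H f = f"
    using lam by (intro banach_fix_type[of lam]) auto
  then obtain f where f: "H f = f" "\<And>g. H g = g \<Longrightarrow> g = f"
    by blast
  show ?thesis
  proof (rule ex1I[of _ "apply_bcontfun f"])
    show "cohom_solution T \<Psi> \<rho> lam (apply_bcontfun f)"
      unfolding cohom_solution_def sol_iff
      using H[of f] f(1) by (simp add: continuous_on_apply_bcontfun)
  next
    fix u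
    assume "cohom_solution T \<Psi> \<rho> lam u"
    then have u: "continuous_on UNIV u" "h u = u"
      by (auto simp: cohom_solution_def sol_iff)
    have "H (Bcontfun u) = Bcontfun u"
      by (simp add: H_def Bcontfun_inverse bc u)
    then have "Bcontfun u = f"
      by (rule f(2))
    then show "u = apply_bcontfun f"
      using Bcontfun_inverse[OF bc[OF u(1)]] by simp
  qed
qed

lemma bij_skew_F:
  fixes T :: "'a \<Rightarrow> 'a" and \<Psi> :: "'a \<Rightarrow> real ^ 'l ^ 'l" and \<rho> :: "'a \<Rightarrow> real ^ 'l"
  assumes T: "bij T" and Psi: "\<And>x. orthogonal_matrix (\<Psi> x)" and lam: "lam \<noteq> 0"
  shows "bij (skew_F T \<Psi> \<rho> lam)"
proof (rule o_bij)
  let ?K = "\<lambda>(y, w). (inv T y, transpose (\<Psi> (inv T y)) *v (lam *\<^sub>R w - \<rho> (inv T y)))"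
  show "?K \<circ> skew_F T \<Psi> \<rho> lam = id"
    using lam by (auto simp: fun_eq_iff skew_F_def orthogonal_matrix_cancel Psi
        bij_is_inj[OF T] simp del: transpose_matrix_vector)
  show "skew_F T \<Psi> \<rho> lam \<circ> ?K = id"
    using lam by (auto simp: fun_eq_iff skew_F_def orthogonal_matrix_cancel Psi
        surj_f_inv_f[OF bij_is_surj[OF T]] simp del: transpose_matrix_vector)
qed

end

theory Submission
  imports Defs
begin

text \<open>The cohomological equation says exactly that the graph of \<open>u\<close> is invariant under \<open>F\<close>, hence
  under \<open>G\<close>.  As \<open>\<Psi>\<close> is orthogonal, \<open>G\<close> contracts distances within fibres by the factor \<open>\<lambda>\<close>, so the
  distance from \<open>G\<^sup>n (x, v)\<close> to the graph is \<open>\<lambda>\<^sup>n |u x - v|\<close>.\<close>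

text \<open>Orthogonality makes \<open>transpose (\<Psi> y)\<close> the inverse of
  \<open>\<Psi> y\<close>, so the fibre equation of \<open>skew_F\<close> can be solved for its
  input. As \<open>skew_F\<close> is injective, checking that it sends the candidate to
  \<open>(x, v)\<close> suffices.\<close>

lemma skew_G_eq:
  assumes "bij T" and "\<And>x. orthogonal_matrix (\<Psi> x)" and "lam \<noteq> 0"
  shows "skew_G T \<Psi> \<rho> lam (x, v)
    = (inv T x, transpose (\<Psi> (inv T x)) *v (lam *\<^sub>R v - \<rho> (inv T x)))"
  unfolding skew_G_def
proof (rule inv_f_eq)
  show "inj (skew_F T \<Psi> \<rho> lam)"
    by (intro bij_is_inj bij_skew_F assms)
  show "skew_F T \<Psi> \<rho> lam (inv T x, transpose (\<Psi> (inv T x)) *v (lam *\<^sub>R v - \<rho> (inv T x))) = (x, v)"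
    using assms by (simp add: skew_F_def orthogonal_matrix_cancel bij_is_surj surj_f_inv_f
        del: transpose_matrix_vector)
qed

lemma skew_G_graph:
  assumes "bij T" and "\<And>x. orthogonal_matrix (\<Psi> x)" and "lam \<noteq> 0"
    and "cohom_solution T \<Psi> \<rho> lam u"
  shows "skew_G T \<Psi> \<rho> lam (x, u x) = (inv T x, u (inv T x))"
proof -
  \<comment> \<open>The equation is read at \<open>inv T x\<close>, so that its shifted term becomes
    \<open>u x\<close>.\<close>
  have "lam *\<^sub>R u (T (inv T x)) - \<Psi> (inv T x) *v u (inv T x) = \<rho> (inv T x)"
    using assms(4) by (simp add: cohom_solution_def)
  then have "lam *\<^sub>R u x - \<rho> (inv T x) = \<Psi> (inv T x) *v u (inv T x)"
    using assms(1) by (simp add: bij_is_surj surj_f_inv_f algebra_simps)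
  then show ?thesis
    using assms(1-3) by (simp add: skew_G_eq orthogonal_matrix_cancel del: transpose_matrix_vector)
qed

lemma norm_skew_G_diff:
  assumes "bij T" and "\<And>x. orthogonal_matrix (\<Psi> x)" and "lam > 0"
  shows "norm (snd (skew_G T \<Psi> \<rho> lam (x, v)) - snd (skew_G T \<Psi> \<rho> lam (x, w))) = lam * norm (v - w)"
proof -
  \<comment> \<open>Both points lie over the same \<open>x\<close>: the \<rho> terms cancel and one
    common matrix factors out.\<close>
  have "snd (skew_G T \<Psi> \<rho> lam (x, v)) - snd (skew_G T \<Psi> \<rho> lam (x, w))
      = transpose (\<Psi> (inv T x)) *v (lam *\<^sub>R (v - w))"
    using assms by (simp add: skew_G_eq algebra_simps flip: matrix_vector_mult_diff_distrib
        del: transpose_matrix_vector)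
  then show ?thesis
    using assms by (simp add: norm_orthogonal_matrix_transpose del: transpose_matrix_vector)
qed

text \<open>Keeps the orbit of \<open>(x, v)\<close> in the same fibre as the graph point it is
  compared with, so that \<open>norm_skew_G_diff\<close> applies at each step.\<close>

lemma fst_skew_G_funpow:
  assumes "bij T" and "\<And>x. orthogonal_matrix (\<Psi> x)" and "lam \<noteq> 0"
  shows "fst ((skew_G T \<Psi> \<rho> lam ^^ n) (x, v)) = (inv T ^^ n) x"
proof (induction n)
  case (Suc n)
  then show ?case
    using assms by (cases "(skew_G T \<Psi> \<rho> lam ^^ n) (x, v)") (simp add: skew_G_eq)
qed simp

lemma norm_graph_diff_skew_G_funpow:
  assumes "bij T" and "\<And>x. orthogonal_matrix (\<Psi> x)" and "lam > 0"
    and "cohom_solution T \<Psi> \<rho> lam u"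
  shows "norm (u ((inv T ^^ n) x) - snd ((skew_G T \<Psi> \<rho> lam ^^ n) (x, v))) = lam ^ n * norm (u x - v)"
proof (induction n)
  case (Suc n)
  let ?G = "skew_G T \<Psi> \<rho> lam"
  let ?y = "(inv T ^^ n) x" and ?w = "snd ((?G ^^ n) (x, v))"
  have "(?G ^^ n) (x, v) = (?y, ?w)"
    using assms by (simp add: prod_eq_iff fst_skew_G_funpow)
  then have "(?G ^^ Suc n) (x, v) = ?G (?y, ?w)"
    by simp
  \<comment> \<open>By invariance the next graph point is itself an image under \<open>?G\<close>,
    so one more step multiplies the distance by exactly \<open>lam\<close>.\<close>
  moreover have "u ((inv T ^^ Suc n) x) = snd (?G (?y, u ?y))"
    using assms by (simp add: skew_G_graph)
  ultimately show ?case
    using assms Suc.IH by (simp only: norm_skew_G_diff) simp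
qed simp

theorem proposition1:
  fixes T :: "'a::metric_space \<Rightarrow> 'a"
    and \<Psi> :: "'a \<Rightarrow> real ^ 'l ^ 'l"
    and \<rho> :: "'a \<Rightarrow> real ^ 'l"
  assumes "compact (UNIV :: 'a set)"
    and "homeomorphism UNIV UNIV T (inv T)"
    and "continuous_on UNIV \<Psi>"
    and "\<forall>x. orthogonal_matrix (\<Psi> x)"
    and "continuous_on UNIV \<rho>"
  shows "\<forall>lam \<in> {0<..<1::real}.
    (\<forall>x. skew_G T \<Psi> \<rho> lam (x, cohom_sol T \<Psi> \<rho> lam x)
          = (inv T x, cohom_sol T \<Psi> \<rho> lam (inv T x))) \<and>
    (\<forall>x v. (\<lambda>n. norm (cohom_sol T \<Psi> \<rho> lam ((inv T ^^ n) x)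
                       - snd ((skew_G T \<Psi> \<rho> lam ^^ n) (x, v)))) \<longlonglongrightarrow> 0)"
proof (intro ballI)
  fix lam :: real
  assume "lam \<in> {0<..<1}"
  then have lam: "0 < lam" "lam < 1"
    by auto
  have T: "bij T" "continuous_on UNIV T"
    using assms(2) by (auto simp: homeomorphism_def bij_def intro: inj_on_inverseI[of _ "inv T"])
  have Psi: "\<And>x. orthogonal_matrix (\<Psi> x)"
    using assms(4) by blast
  define u where "u = cohom_sol T \<Psi> \<rho> lam"
  \<comment> \<open>\<open>cohom_sol\<close> is a definite description; unique existence, obtained
    from a contraction on bounded continuous functions, yields its defining property.\<close>
  have u: "cohom_solution T \<Psi> \<rho> lam u"
    unfolding u_def cohom_sol_def
    using theI'[OF cohom_solution_ex1[OF assms(1) T(2) assms(3) Psi assms(5) lam]] .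
  have "(\<lambda>n. lam ^ n * norm (u x - v)) \<longlonglongrightarrow> 0" for x v
    using lam by (intro tendsto_mult_left_zero LIMSEQ_power_zero) simp
  then show "(\<forall>x. skew_G T \<Psi> \<rho> lam (x, cohom_sol T \<Psi> \<rho> lam x)
          = (inv T x, cohom_sol T \<Psi> \<rho> lam (inv T x))) \<and>
    (\<forall>x v. (\<lambda>n. norm (cohom_sol T \<Psi> \<rho> lam ((inv T ^^ n) x)
                       - snd ((skew_G T \<Psi> \<rho> lam ^^ n) (x, v)))) \<longlonglongrightarrow> 0)"
    using skew_G_graph[OF T(1) Psi _ u] norm_graph_diff_skew_G_funpow[OF T(1) Psi lam(1) u] lam(1)
    by (simp flip: u_def)
qed

end
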